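(* Let $k\ge 1$ and let $G$ be a connected $k$-regular vertex-transitive graph of even order. Then $mp(G)=k$.
   Context: All graphs are finite and simple. A graph $G$ is vertex-transitive if for any two vertices $x,y$ there is an automorphism $\varphi$ of $G$ with $\varphi(x)=y$. For a graph $G$ of even order, a matching preclusion set is a set $S\subseteq E(G)$ such that $G-S$ (the graph obtained by deleting the edges in $S$) has no perfect matching. The matching preclusion number $mp(G)$ is the minimum cardinality of a matching preclusion set. *)

theory Defs
  imports Main
begin

text \<open>
  A graph is given by its vertex set \<open>V\<close> and its edge set \<open>E\<close>, an edge being the two-element set
  of its endpoints; this encoding excludes loops and parallel edges.
\<close>

definition finite_simple_graph :: "'a set \<Rightarrow> 'a set set \<Rightarrow> bool" where
  "finite_simple_graph V E \<longleftrightarrow> finite V \<and> (\<forall>e\<in>E. e \<subseteq> V \<and> card e = 2)"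

definition graph_degree :: "'a set set \<Rightarrow> 'a \<Rightarrow> nat" where
  "graph_degree E v = card {e \<in> E. v \<in> e}"

definition regular_graph :: "nat \<Rightarrow> 'a set \<Rightarrow> 'a set set \<Rightarrow> bool" where
  "regular_graph k V E \<longleftrightarrow> (\<forall>v\<in>V. graph_degree E v = k)"

definition adjacency :: "'a set set \<Rightarrow> ('a \<times> 'a) set" where
  "adjacency E = {(x, y). {x, y} \<in> E}"

text \<open>
  The graph without vertices is not connected. (It would be vacuously regular of every degree,
  and it has no matching preclusion set, since the empty matching is perfect.)
\<close>

definition connected_graph :: "'a set \<Rightarrow> 'a set set \<Rightarrow> bool" where
  "connected_graph V E \<longleftrightarrow> V \<noteq> {} \<and> (\<forall>x\<in>V. \<forall>y\<in>V. (x, y) \<in> (adjacency E)\<^sup>*)"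

definition graph_automorphism :: "'a set \<Rightarrow> 'a set set \<Rightarrow> ('a \<Rightarrow> 'a) \<Rightarrow> bool" where
  "graph_automorphism V E \<phi> \<longleftrightarrow>
     bij_betw \<phi> V V \<and> (\<forall>x\<in>V. \<forall>y\<in>V. {x, y} \<in> E \<longleftrightarrow> {\<phi> x, \<phi> y} \<in> E)"

definition vertex_transitive :: "'a set \<Rightarrow> 'a set set \<Rightarrow> bool" where
  "vertex_transitive V E \<longleftrightarrow>
     (\<forall>x\<in>V. \<forall>y\<in>V. \<exists>\<phi>. graph_automorphism V E \<phi> \<and> \<phi> x = y)"

definition graph_matching :: "'a set set \<Rightarrow> 'a set set \<Rightarrow> bool" where
  "graph_matching E M \<longleftrightarrow> M \<subseteq> E \<and> pairwise disjnt M"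

definition perfect_matching :: "'a set \<Rightarrow> 'a set set \<Rightarrow> 'a set set \<Rightarrow> bool" where
  "perfect_matching V E M \<longleftrightarrow> graph_matching E M \<and> (\<forall>v\<in>V. \<exists>e\<in>M. v \<in> e)"

definition matching_preclusion_set :: "'a set \<Rightarrow> 'a set set \<Rightarrow> 'a set set \<Rightarrow> bool" where
  "matching_preclusion_set V E S \<longleftrightarrow> S \<subseteq> E \<and> \<not> (\<exists>M. perfect_matching V (E - S) M)"

definition matching_preclusion_number :: "'a set \<Rightarrow> 'a set set \<Rightarrow> nat" where
  "matching_preclusion_number V E = Min (card ` {S. matching_preclusion_set V E S})"

end

theory Submission
  imports Defs
begin

text \<open>
  The edges at one vertex form a matching preclusion set of size \<open>k\<close>. Conversely, let \<open>S\<close> be a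
  matching preclusion set. Two facts together force \<open>card S \<ge> k\<close>.

  One is the nontrivial direction of the Tutte--Berge formula, with unions of components in place
  of odd components (\<open>tutte_berge_barrier\<close>): the graph with edge set \<open>E - S\<close> has a vertex set \<open>A\<close> and at
  least \<open>card A + 2\<close> nonempty, pairwise disjoint sets outside \<open>A\<close> whose neighbours all lie in
  themselves or in \<open>A\<close>. The \<open>2\<close> comes from the order being even. It is proved by induction on
  the number of vertices: a vertex covered by every maximum matching is put into \<open>A\<close>, and if there is
  none, then Gallai's argument (\<open>gallai_exchange\<close>) shows that not being missed together by a
  maximum matching is an equivalence relation, whose classes are the required sets.

  The other is that every edge cut of a connected vertex-transitive graph has at least \<open>k\<close> edges
  (\<open>edge_cut_ge_degree\<close>). By submodularity of the cut size, a smallest set among those that attain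
  the minimum cut is mapped to itself by every automorphism that does not move it off itself, so
  all its vertices have the same number of outgoing edges, and a count finishes.

  Hence at least \<open>k * (card A + 2)\<close> edges, counted with multiplicity, leave the sets. Each of
  them either meets \<open>A\<close>, and is then counted once, or belongs to \<open>S\<close>, and is then counted at most
  twice. So \<open>k * (card A + 2) \<le> k * card A + 2 * card S\<close>.
\<close>

section \<open>Maximum matchings\<close>

lemma finite_simple_graph_finite_edges:
  assumes "finite_simple_graph V E"
  shows "finite E"
proof (rule finite_subset)
  show "E \<subseteq> Pow V" using assms by (auto simp: finite_simple_graph_def)
  show "finite (Pow V)" using assms by (simp add: finite_simple_graph_def)
qed

lemma edge_other_end:
  assumes "card e = 2" "x \<in> e"
  obtains y where "e = {x, y}" "x \<noteq> y"
  using assms by (metis card_2_iff doubleton_eq_iff insertE singletonD)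

definition maximum_matching :: "'a set set \<Rightarrow> 'a set set \<Rightarrow> bool" where
  "maximum_matching E M \<longleftrightarrow>
     graph_matching E M \<and> (\<forall>N. graph_matching E N \<longrightarrow> card N \<le> card M)"

lemma maximum_matching_exists:
  assumes "finite E"
  shows "\<exists>M. maximum_matching E M"
proof -
  have "graph_matching E {}"
    by (simp add: graph_matching_def)
  moreover have "\<forall>N. graph_matching E N \<longrightarrow> card N < Suc (card E)"
    using assms by (simp add: graph_matching_def card_mono less_Suc_eq_le)
  ultimately show ?thesis
    unfolding maximum_matching_def by (rule ex_has_greatest_nat)
qed

lemma card_covered:
  assumes "finite_simple_graph V E" "graph_matching E M"
  shows "card (\<Union>M) = 2 * card M"
proof -
  have *: "\<forall>e\<in>M. card e = 2" "pairwise disjnt M"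
    using assms unfolding finite_simple_graph_def graph_matching_def by auto
  have "card (\<Union>M) = (\<Sum>e\<in>M. card e)"
    using * by (intro card_Union_disjoint) (auto intro: card_ge_0_finite)
  then show ?thesis using * by simp
qed

lemma matching_edge_unique:
  assumes "graph_matching E M" "e \<in> M" "f \<in> M" "x \<in> e" "x \<in> f"
  shows "e = f"
proof (rule ccontr)
  assume "e \<noteq> f"
  then have "disjnt e f"
    using assms(1-3) by (simp add: graph_matching_def pairwise_def)
  then show False using assms(4,5) by (auto simp: disjnt_def)
qed

lemma matching_insert:
  assumes "graph_matching E M" "e \<in> E" "e \<inter> \<Union>M = {}"
  shows "graph_matching E (insert e M)"
  using assms unfolding graph_matching_def
  by (auto simp: pairwise_insert disjnt_def)

lemma maximum_matching_maximal:
  assumes "finite_simple_graph V E" "maximum_matching E M" "e \<in> E"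
  shows "e \<inter> \<Union>M \<noteq> {}"
proof
  assume *: "e \<inter> \<Union>M = {}"
  have "graph_matching E (insert e M)"
    using assms(2,3) * by (auto simp: maximum_matching_def intro: matching_insert)
  then have "card (insert e M) \<le> card M"
    using assms(2) by (simp add: maximum_matching_def)
  moreover have "finite M"
    using assms(2) finite_simple_graph_finite_edges[OF assms(1)]
    by (auto simp: maximum_matching_def graph_matching_def intro: finite_subset)
  moreover have "e \<noteq> {}"
    using assms(1,3) by (auto simp: finite_simple_graph_def)
  then have "e \<notin> M" using * by auto
  ultimately show False by simp
qed

text \<open>
  As long as \<open>N\<close> covers both \<open>u\<close> and \<open>w\<close>, equality of sizes gives a vertex \<open>x \<noteq> v\<close> covered
  by \<open>M\<close> and missed by \<open>N\<close>. Exchanging at the \<open>M\<close>-edge of \<open>x\<close> makes \<open>N\<close> agree with \<open>M\<close> in one more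
  edge and leaves \<open>v\<close> uncovered, so the process stops. This replaces the usual symmetric
  difference with its alternating paths.
\<close>

lemma gallai_exchange:
  assumes G: "finite_simple_graph V E"
    and M: "maximum_matching E M" "u \<notin> \<Union>M" "w \<notin> \<Union>M" "u \<noteq> w"
    and N: "maximum_matching E N" "v \<notin> \<Union>N"
  shows "\<exists>N'. maximum_matching E N' \<and> v \<notin> \<Union>N' \<and> (u \<notin> \<Union>N' \<or> w \<notin> \<Union>N')"
  using N
proof (induction "card (N - M)" arbitrary: N rule: less_induct)
  case less
  note maxN = less.prems(1) and v = less.prems(2)
  show ?case
  proof (cases "u \<in> \<Union>N \<and> w \<in> \<Union>N")
    case False
    then show ?thesis using maxN v by blast
  next
    case True
    have gM: "graph_matching E M" and gN: "graph_matching E N"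
      and eq: "card M = card N"
      using M(1) maxN by (auto simp: maximum_matching_def intro: le_antisym)
    have finE: "finite E" using G by (rule finite_simple_graph_finite_edges)
    have sub: "M \<subseteq> E" "N \<subseteq> E" using gM gN by (auto simp: graph_matching_def)
    then have finM: "finite M" and finN: "finite N"
      using finE by (auto intro: finite_subset)
    have fin: "finite (\<Union>M)" "finite (\<Union>N)"
      using G sub unfolding finite_simple_graph_def
      by (meson Sup_least finite_subset subsetD)+
    have "card (\<Union>M - \<Union>N) = card (\<Union>N - \<Union>M)"
      using card_le_sym_Diff[OF fin] card_le_sym_Diff[OF fin(2,1)]
        card_covered[OF G gM] card_covered[OF G gN] eq by simp
    moreover have "card {u, w} \<le> card (\<Union>N - \<Union>M)"
      using True M fin by (intro card_mono) auto
    ultimately have "\<not> card (\<Union>M - \<Union>N) \<le> card {v}"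
      using M(4) by simp
    then have "\<not> \<Union>M - \<Union>N \<subseteq> {v}"
      by (meson card_mono finite.simps)
    then obtain x where x: "x \<in> \<Union>M" "x \<notin> \<Union>N" "x \<noteq> v" by blast
    then obtain e where e: "e \<in> M" "x \<in> e" by blast
    then have "card e = 2" "e \<in> E"
      using G sub by (auto simp: finite_simple_graph_def)
    then obtain y where y: "e = {x, y}" "x \<noteq> y"
      using edge_other_end e(2) by metis
    have "y \<in> \<Union>N"
      using maximum_matching_maximal[OF G maxN \<open>e \<in> E\<close>] y x by auto
    then obtain f where f: "f \<in> N" "y \<in> f" by blast
    let ?N = "insert e (N - {f})"
    have "e \<inter> \<Union>(N - {f}) = {}"
      using y x f matching_edge_unique[OF gN f(1)] by auto
    moreover have "graph_matching E (N - {f})"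
      using gN by (auto simp: graph_matching_def pairwise_def)
    ultimately have gN': "graph_matching E ?N"
      using \<open>e \<in> E\<close> matching_insert by blast
    have "e \<notin> N" using x e by blast
    then have "card ?N = card N"
      using finN f card_Suc_Diff1[OF finN f(1)] by simp
    with gN' maxN have "maximum_matching E ?N"
      by (simp add: maximum_matching_def)
    moreover have "v \<notin> \<Union>?N"
      using v x y \<open>y \<in> \<Union>N\<close> by auto
    moreover have "f \<notin> M"
      using matching_edge_unique[OF gM e(1)] f y x by blast
    then have "?N - M \<subset> N - M"
      using e f by auto
    then have "card (?N - M) < card (N - M)"
      using finN by (simp add: psubset_card_mono)
    ultimately show ?thesis using less.hyps by blast
  qed
qed

section \<open>The Tutte--Berge barrier\<close>

text \<open>
  The condition on edges says that each member of \<open>C\<close> is a union of components of the graph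
  without \<open>A\<close>. Phrased in this way it survives the step from \<open>A\<close> to \<open>insert v A\<close> when the
  vertex \<open>v\<close> is put back.
\<close>

definition barrier :: "'a set \<Rightarrow> 'a set set \<Rightarrow> 'a set \<Rightarrow> 'a set set \<Rightarrow> bool" where
  "barrier V E A C \<longleftrightarrow> A \<subseteq> V \<and> pairwise disjnt C \<and>
     (\<forall>X\<in>C. X \<noteq> {} \<and> X \<subseteq> V - A \<and> (\<forall>e\<in>E. e \<inter> X \<noteq> {} \<longrightarrow> e \<subseteq> X \<union> A))"

text \<open>
  The classes of the relation ``no maximum matching misses both'' are closed under adjacency,
  because an edge with both ends missed would enlarge the matching, and the vertices missed by one
  maximum matching lie in different classes.
\<close>

lemma barrier_all_vertices_avoidable:
  assumes G: "finite_simple_graph V E" and M: "maximum_matching E M"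
    and avoid: "\<And>v. v \<in> V \<Longrightarrow> \<exists>N. maximum_matching E N \<and> v \<notin> \<Union>N"
  shows "\<exists>C. barrier V E {} C \<and> card V \<le> card C + 2 * card M"
proof -
  define R where "R = {(x, y). x \<in> V \<and> y \<in> V \<and>
    (x \<noteq> y \<longrightarrow> \<not> (\<exists>N. maximum_matching E N \<and> x \<notin> \<Union>N \<and> y \<notin> \<Union>N))}"
  have finV: "finite V" using G by (simp add: finite_simple_graph_def)
  have "equiv V R"
  proof (rule equivI)
    show "R \<subseteq> V \<times> V" by (auto simp: R_def)
    show "refl_on V R" by (auto simp: R_def refl_on_def)
    show "sym R" by (auto simp: R_def sym_def)
    show "trans R"
    proof (rule transI)
      fix x y z assume xy: "(x, y) \<in> R" and yz: "(y, z) \<in> R"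
      show "(x, z) \<in> R"
      proof (rule ccontr)
        assume "(x, z) \<notin> R"
        then obtain N where N: "maximum_matching E N" "x \<notin> \<Union>N" "z \<notin> \<Union>N" "x \<noteq> z"
          using xy yz unfolding R_def by blast
        have "y \<in> V" using xy by (simp add: R_def)
        then obtain N0 where "maximum_matching E N0" "y \<notin> \<Union>N0"
          using avoid by blast
        then obtain N' where N': "maximum_matching E N'" "y \<notin> \<Union>N'" "x \<notin> \<Union>N' \<or> z \<notin> \<Union>N'"
          using gallai_exchange[OF G N] by blast
        have "x \<noteq> y" "y \<noteq> z"
          using N xy yz unfolding R_def by blast+
        then show False using N' xy yz unfolding R_def by blast
      qed
    qed
  qed
  note R = this
  have closed: "e \<subseteq> X" if X: "X \<in> V // R" and e: "e \<in> E" "e \<inter> X \<noteq> {}" for X e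
  proof -
    obtain x where x: "x \<in> e" "x \<in> X" using e by blast
    have "card e = 2" "e \<subseteq> V" using G e by (auto simp: finite_simple_graph_def)
    then obtain y where y: "e = {x, y}" "x \<noteq> y"
      using edge_other_end x by metis
    have "(x, y) \<in> R"
    proof (rule ccontr)
      assume "(x, y) \<notin> R"
      moreover have "x \<in> V" "y \<in> V" using y \<open>e \<subseteq> V\<close> by auto
      ultimately obtain N where N: "maximum_matching E N" "x \<notin> \<Union>N" "y \<notin> \<Union>N"
        unfolding R_def by blast
      have "{x, y} \<inter> \<Union>N \<noteq> {}"
        using maximum_matching_maximal[OF G N(1) e(1)] y(1) by simp
      then show False using N(2,3) by simp
    qed
    then have "y \<in> X"
      using in_quotient_imp_closed[OF R X x(2)] by blast
    then show ?thesis using x y by blast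
  qed
  have "barrier V E {} (V // R)"
    unfolding barrier_def
  proof (intro conjI ballI impI)
    show "pairwise disjnt (V // R)"
      using quotient_disj[OF R] by (fastforce simp: pairwise_def disjnt_def)
    fix X assume X: "X \<in> V // R"
    show "X \<noteq> {}" "X \<subseteq> V - {}"
      using in_quotient_imp_non_empty[OF R X] in_quotient_imp_subset[OF R X] by auto
    show "e \<subseteq> X \<union> {}" if "e \<in> E" "e \<inter> X \<noteq> {}" for e
      using closed[OF X that] by simp
  qed simp
  moreover have "card V \<le> card (V // R) + 2 * card M"
  proof -
    have gM: "graph_matching E M" using M by (simp add: maximum_matching_def)
    then have sub: "\<Union>M \<subseteq> V"
      using G by (auto simp: graph_matching_def finite_simple_graph_def)
    have "inj_on (\<lambda>x. R `` {x}) (V - \<Union>M)"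
    proof (rule inj_onI)
      fix x y assume *: "x \<in> V - \<Union>M" "y \<in> V - \<Union>M" "R `` {x} = R `` {y}"
      then have "(x, y) \<in> R" using eq_equiv_class_iff[OF R] by blast
      then show "x = y" using * M unfolding R_def by blast
    qed
    moreover have "(\<lambda>x. R `` {x}) ` (V - \<Union>M) \<subseteq> V // R"
      by (auto intro: quotientI)
    moreover have "finite (V // R)"
      using finV R by (simp add: finite_quotient equiv_type)
    ultimately have "card (V - \<Union>M) \<le> card (V // R)"
      by (rule card_inj_on_le)
    moreover have "card (V - \<Union>M) = card V - 2 * card M"
      using card_covered[OF G gM] sub finV
      by (simp add: card_Diff_subset finite_subset)
    ultimately show ?thesis by simp
  qed
  ultimately show ?thesis by blast
qed

text \<open>
  Deleting a vertex that every maximum matching covers lowers the matching number by one. The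
  number of missed vertices then grows by one, which pays for putting the vertex into \<open>A\<close>.
\<close>

theorem tutte_berge_barrier:
  assumes "finite_simple_graph V E" "maximum_matching E M"
  shows "\<exists>A C. barrier V E A C \<and> card V + card A \<le> card C + 2 * card M"
  using assms
proof (induction "card V" arbitrary: V E M rule: less_induct)
  case less
  note G = less.prems(1) and M = less.prems(2)
  have finV: "finite V" using G by (simp add: finite_simple_graph_def)
  show ?case
  proof (cases "\<forall>v\<in>V. \<exists>N. maximum_matching E N \<and> v \<notin> \<Union>N")
    case True
    then show ?thesis
      using barrier_all_vertices_avoidable[OF G M] by (metis add.right_neutral card.empty)
  next
    case False
    then obtain v where v: "v \<in> V" "\<And>N. maximum_matching E N \<Longrightarrow> v \<in> \<Union>N" by blast
    then obtain e where e: "e \<in> M" "v \<in> e" using M by blast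
    let ?E = "{e \<in> E. v \<notin> e}"
    have gM: "graph_matching E M" using M by (simp add: maximum_matching_def)
    have finM: "finite M"
      using gM finite_simple_graph_finite_edges[OF G]
      by (auto simp: graph_matching_def intro: finite_subset)
    have G': "finite_simple_graph (V - {v}) ?E"
      using G by (auto simp: finite_simple_graph_def)
    have "maximum_matching ?E (M - {e})"
      unfolding maximum_matching_def
    proof (intro conjI allI impI)
      show "graph_matching ?E (M - {e})"
        using gM e by (auto simp: graph_matching_def pairwise_def disjnt_def)
      fix N assume N: "graph_matching ?E N"
      then have "graph_matching E N" and "v \<notin> \<Union>N" by (auto simp: graph_matching_def)
      then have "card N < card M"
        using v(2)[of N] M unfolding maximum_matching_def by (metis le_trans not_le)
      then show "card N \<le> card (M - {e})"
        using e finM by simp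
    qed
    moreover have "card (V - {v}) < card V"
      using v(1) finV by (intro psubset_card_mono) auto
    ultimately obtain A C where AC: "barrier (V - {v}) ?E A C"
      and le: "card (V - {v}) + card A \<le> card C + 2 * card (M - {e})"
      using less.hyps G' by blast
    have "barrier V E (insert v A) C"
      unfolding barrier_def
    proof (intro conjI ballI impI)
      show "insert v A \<subseteq> V" "pairwise disjnt C"
        using AC v(1) by (auto simp: barrier_def)
      fix X assume X: "X \<in> C"
      show "X \<noteq> {}" "X \<subseteq> V - insert v A"
        using AC X by (auto simp: barrier_def)
      fix f assume f: "f \<in> E" "f \<inter> X \<noteq> {}"
      show "f \<subseteq> X \<union> insert v A"
      proof (cases "v \<in> f")
        case False
        then show ?thesis using AC X f by (fastforce simp: barrier_def)
      next
        case True
        have "card f = 2" using G f by (simp add: finite_simple_graph_def)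
        then obtain y where "f = {v, y}" using edge_other_end True by metis
        moreover have "v \<notin> X" using AC X by (auto simp: barrier_def)
        ultimately show ?thesis using f by auto
      qed
    qed
    moreover have "v \<notin> A" "finite A"
      using AC finV by (auto simp: barrier_def intro: finite_subset)
    moreover have "card M > 0" "card V > 0"
      using e v(1) finM finV by (auto simp: card_gt_0_iff)
    ultimately have "card V + card (insert v A) \<le> card C + 2 * card M"
      using le e v(1) finM finV by simp
    then show ?thesis using \<open>barrier V E (insert v A) C\<close> by blast
  qed
qed

section \<open>Edge cuts of vertex-transitive graphs\<close>

definition edge_cut :: "'a set set \<Rightarrow> 'a set \<Rightarrow> 'a set set" where
  "edge_cut E X = {e \<in> E. e \<inter> X \<noteq> {} \<and> \<not> e \<subseteq> X}"

lemma edge_cut_submodular: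
  assumes "finite E"
  shows "card (edge_cut E (X \<inter> Y)) + card (edge_cut E (X \<union> Y))
    \<le> card (edge_cut E X) + card (edge_cut E Y)"
proof -
  have fin: "finite (edge_cut E Z)" for Z
    using assms by (simp add: edge_cut_def)
  have "card (edge_cut E (X \<inter> Y) \<union> edge_cut E (X \<union> Y)) \<le> card (edge_cut E X \<union> edge_cut E Y)"
    using fin by (intro card_mono) (auto simp: edge_cut_def)
  moreover have "card (edge_cut E (X \<inter> Y) \<inter> edge_cut E (X \<union> Y))
      \<le> card (edge_cut E X \<inter> edge_cut E Y)"
    using fin by (intro card_mono) (auto simp: edge_cut_def)
  ultimately show ?thesis
    using card_Un_Int[OF fin fin, of "X \<inter> Y" "X \<union> Y"] card_Un_Int[OF fin fin, of X Y] by simp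
qed

lemma edge_cut_complement:
  assumes "finite_simple_graph V E" "X \<subseteq> V"
  shows "edge_cut E (V - X) = edge_cut E X"
proof -
  have "e \<inter> (V - X) \<noteq> {} \<and> \<not> e \<subseteq> V - X \<longleftrightarrow> e \<inter> X \<noteq> {} \<and> \<not> e \<subseteq> X" if "e \<in> E" for e
  proof -
    have "e \<subseteq> V" using assms(1) that by (simp add: finite_simple_graph_def)
    then show ?thesis by auto
  qed
  then show ?thesis unfolding edge_cut_def by (intro Collect_cong) auto
qed

lemma edge_cut_nonempty:
  assumes "connected_graph V E" "X \<noteq> {}" "X \<subset> V"
  shows "edge_cut E X \<noteq> {}"
proof
  assume empty: "edge_cut E X = {}"
  obtain x y where xy: "x \<in> X" "y \<in> V" "y \<notin> X" using assms(2,3) by blast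
  have "(x, y) \<in> (adjacency E)\<^sup>*"
    using assms(1,3) xy unfolding connected_graph_def by blast
  then have "y \<in> X"
  proof (induction rule: rtrancl_induct)
    case base
    show ?case by (rule xy(1))
  next
    case (step y z)
    then have "{y, z} \<in> E" by (simp add: adjacency_def)
    then show ?case using step.IH empty by (auto simp: edge_cut_def)
  qed
  then show False using xy by simp
qed

lemma automorphism_image_edges:
  assumes G: "finite_simple_graph V E" and \<phi>: "graph_automorphism V E \<phi>"
  shows "(`) \<phi> ` E = E" and "inj_on ((`) \<phi>) E"
proof -
  have inj: "inj_on \<phi> V" using \<phi> by (simp add: graph_automorphism_def bij_betw_def)
  show injE: "inj_on ((`) \<phi>) E"
    using G by (intro inj_on_subset[OF inj_on_image_Pow[OF inj]])
      (auto simp: finite_simple_graph_def)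
  have "(`) \<phi> ` E \<subseteq> E"
  proof (rule image_subsetI)
    fix e assume e: "e \<in> E"
    then have "card e = 2" "e \<subseteq> V" using G by (auto simp: finite_simple_graph_def)
    then obtain x y where "e = {x, y}" by (auto simp: card_2_iff)
    then show "\<phi> ` e \<in> E" using \<phi> e \<open>e \<subseteq> V\<close> by (simp add: graph_automorphism_def)
  qed
  then show "(`) \<phi> ` E = E"
    using finite_simple_graph_finite_edges[OF G] injE by (simp add: endo_inj_surj)
qed

lemma automorphism_card_edges:
  assumes G: "finite_simple_graph V E" and \<phi>: "graph_automorphism V E \<phi>"
    and PQ: "\<And>e. e \<in> E \<Longrightarrow> Q (\<phi> ` e) \<longleftrightarrow> P e"
  shows "card {e \<in> E. Q e} = card {e \<in> E. P e}"
proof -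
  have "{e \<in> E. Q e} = {e \<in> (`) \<phi> ` E. Q e}"
    by (simp add: automorphism_image_edges(1)[OF G \<phi>])
  also have "\<dots> = (`) \<phi> ` {e \<in> E. P e}"
    using PQ by blast
  also have "card \<dots> = card {e \<in> E. P e}"
    by (intro card_image inj_on_subset[OF automorphism_image_edges(2)[OF G \<phi>]]) auto
  finally show ?thesis .
qed

lemma inj_on_image_subset_eq_iff:
  assumes "inj_on f C" "A \<subseteq> C" "B \<subseteq> C"
  shows "f ` A \<subseteq> f ` B \<longleftrightarrow> A \<subseteq> B"
proof
  assume "f ` A \<subseteq> f ` B"
  then show "A \<subseteq> B" using assms inj_on_image_mem_iff[OF assms(1) _ assms(3)] by blast
qed auto

lemma automorphism_card_edge_cut:
  assumes G: "finite_simple_graph V E" and \<phi>: "graph_automorphism V E \<phi>" and X: "X \<subseteq> V"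
  shows "card (edge_cut E (\<phi> ` X)) = card (edge_cut E X)"
  unfolding edge_cut_def
proof (rule automorphism_card_edges[OF G \<phi>])
  fix e assume "e \<in> E"
  then have e: "e \<subseteq> V" using G by (simp add: finite_simple_graph_def)
  have inj: "inj_on \<phi> V" using \<phi> by (simp add: graph_automorphism_def bij_betw_def)
  have "\<phi> ` e \<inter> \<phi> ` X = \<phi> ` (e \<inter> X)"
    using inj_on_image_Int[OF inj e X] by simp
  moreover have "\<phi> ` e \<subseteq> \<phi> ` X \<longleftrightarrow> e \<subseteq> X"
    using inj_on_image_subset_eq_iff[OF inj e X] .
  ultimately show "(\<phi> ` e \<inter> \<phi> ` X \<noteq> {} \<and> \<not> \<phi> ` e \<subseteq> \<phi> ` X) \<longleftrightarrow> (e \<inter> X \<noteq> {} \<and> \<not> e \<subseteq> X)"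
    by simp
qed

text \<open>
  Each vertex of \<open>X\<close> has \<open>s\<close> edges leaving \<open>X\<close> and hence at least \<open>k - s\<close> neighbours in \<open>X\<close>, so
  \<open>k \<le> s + card X - 1\<close>. This is at most the cut size \<open>s * card X\<close> since both factors are positive.
\<close>

lemma edge_cut_ge_degree_uniform:
  assumes G: "finite_simple_graph V E" and reg: "regular_graph k V E"
    and X: "X \<noteq> {}" "X \<subseteq> V" and cut: "edge_cut E X \<noteq> {}"
    and s: "\<And>x. x \<in> X \<Longrightarrow> card {e \<in> E. x \<in> e \<and> \<not> e \<subseteq> X} = s"
  shows "k \<le> card (edge_cut E X)"
proof -
  have finE: "finite E" using G by (rule finite_simple_graph_finite_edges)
  have finX: "finite X" using G X by (auto simp: finite_simple_graph_def intro: finite_subset)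
  have edge: "card e = 2" if "e \<in> E" for e
    using G that by (simp add: finite_simple_graph_def)
  have "edge_cut E X = (\<Union>x\<in>X. {e \<in> E. x \<in> e \<and> \<not> e \<subseteq> X})"
    by (auto simp: edge_cut_def)
  also have "card \<dots> = (\<Sum>x\<in>X. card {e \<in> E. x \<in> e \<and> \<not> e \<subseteq> X})"
  proof (rule card_UN_disjoint)
    show "\<forall>x\<in>X. \<forall>y\<in>X. x \<noteq> y \<longrightarrow>
        {e \<in> E. x \<in> e \<and> \<not> e \<subseteq> X} \<inter> {e \<in> E. y \<in> e \<and> \<not> e \<subseteq> X} = {}"
    proof (intro ballI impI equals0I)
      fix x y e assume *: "x \<in> X" "y \<in> X" "x \<noteq> y"
        "e \<in> {e \<in> E. x \<in> e \<and> \<not> e \<subseteq> X} \<inter> {e \<in> E. y \<in> e \<and> \<not> e \<subseteq> X}"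
      then obtain z where "e = {x, z}"
        using edge edge_other_end by (metis (no_types, lifting) IntD1 mem_Collect_eq)
      then show False using * by auto
    qed
  qed (use finX finE in auto)
  also have "\<dots> = card X * s" using s by simp
  finally have card_cut: "card (edge_cut E X) = card X * s" .
  obtain u where u: "u \<in> X" using X by blast
  let ?In = "{e \<in> E. u \<in> e \<and> e \<subseteq> X}" and ?Out = "{e \<in> E. u \<in> e \<and> \<not> e \<subseteq> X}"
  have "?In \<subseteq> (\<lambda>w. {u, w}) ` (X - {u})"
  proof
    fix e assume "e \<in> ?In"
    then have e: "e \<in> E" "u \<in> e" "e \<subseteq> X" by auto
    then obtain y where "e = {u, y}" "u \<noteq> y" using edge edge_other_end by metis
    then show "e \<in> (\<lambda>w. {u, w}) ` (X - {u})" using e by auto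
  qed
  then have "card ?In \<le> card (X - {u})"
    using finX by (meson finite_Diff surj_card_le)
  moreover have "k = card {e \<in> E. u \<in> e}"
    using reg u X by (auto simp: regular_graph_def graph_degree_def)
  moreover have "{e \<in> E. u \<in> e} = ?In \<union> ?Out" by blast
  then have "card {e \<in> E. u \<in> e} \<le> card ?In + card ?Out"
    by (simp add: card_Un_le)
  moreover have "card ?Out = s" using s u by simp
  ultimately have k: "k \<le> (card X - 1) + s"
    using u finX by simp
  have "card (edge_cut E X) > 0"
    using cut finE by (simp add: card_gt_0_iff edge_cut_def)
  then obtain a b where "card X = Suc a" "s = Suc b"
    using card_cut by (metis gr0_conv_Suc nat_0_less_mult_iff)
  then show ?thesis using k card_cut by simp
qed

text \<open>
  A smallest vertex set among those of minimum cut size is at most half of \<open>V\<close>, because its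
  complement has the same cut. Hence such a set \<open>X\<close> and an image \<open>Y\<close> of it that meets \<open>X\<close> do not
  cover \<open>V\<close>, and submodularity makes \<open>X \<inter> Y\<close> a set of minimum cut size as well, so \<open>Y = X\<close>.
\<close>

theorem edge_cut_ge_degree:
  assumes G: "finite_simple_graph V E" and conn: "connected_graph V E"
    and reg: "regular_graph k V E" and vt: "vertex_transitive V E"
    and Z: "Z \<noteq> {}" "Z \<subset> V"
  shows "k \<le> card (edge_cut E Z)"
proof -
  have finV: "finite V" using G by (simp add: finite_simple_graph_def)
  have finE: "finite E" using G by (rule finite_simple_graph_finite_edges)
  let ?P = "\<lambda>X. X \<noteq> {} \<and> X \<subset> V" and ?d = "\<lambda>X. card (edge_cut E X)"
  obtain X0 where X0: "?P X0" "\<And>Y. ?P Y \<Longrightarrow> ?d X0 \<le> ?d Y"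
    using ex_has_least_nat[of ?P Z ?d] Z by blast
  obtain X where "(?P X \<and> ?d X = ?d X0) \<and> (\<forall>Y. ?P Y \<and> ?d Y = ?d X0 \<longrightarrow> card X \<le> card Y)"
    using ex_has_least_nat[of "\<lambda>X. ?P X \<and> ?d X = ?d X0" X0 card, OF conjI[OF X0(1) refl]]
    by (rule exE)
  then have X: "?P X" "?d X = ?d X0"
    and min: "?P Y \<Longrightarrow> ?d Y = ?d X0 \<Longrightarrow> card X \<le> card Y" for Y
    by simp_all
  have XV: "X \<subseteq> V" and finX: "finite X" using X finV by (auto intro: finite_subset)
  have "card X \<le> card (V - X)"
    using X edge_cut_complement[OF G XV] by (intro min) auto
  then have half: "2 * card X \<le> card V"
    using card_Diff_subset[OF finX XV] by simp
  have stable: "\<phi> ` X = X" if \<phi>: "graph_automorphism V E \<phi>" and meet: "X \<inter> \<phi> ` X \<noteq> {}" for \<phi>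
  proof (rule ccontr)
    let ?Y = "\<phi> ` X"
    assume ne: "?Y \<noteq> X"
    have bij: "bij_betw \<phi> V V" using \<phi> by (simp add: graph_automorphism_def)
    then have cardY: "card ?Y = card X"
      using XV by (meson bij_betw_imp_inj_on card_image inj_on_subset)
    have YV: "?Y \<subseteq> V" using bij XV by (auto simp: bij_betw_def)
    have "?P (X \<inter> ?Y)" using meet X by blast
    have "X \<inter> ?Y \<subset> X"
      using ne cardY card_subset_eq[of ?Y X] finX by auto
    then have "card (X \<inter> ?Y) < card X"
      using finX by (simp add: psubset_card_mono)
    then have "?d (X \<inter> ?Y) \<noteq> ?d X0"
      using min[OF \<open>?P (X \<inter> ?Y)\<close>] by linarith
    then have "?d (X \<inter> ?Y) > ?d X0"
      using X0(2)[OF \<open>?P (X \<inter> ?Y)\<close>] by simp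
    moreover have "card (X \<union> ?Y) < card V"
    proof -
      have "card (X \<union> ?Y) + card (X \<inter> ?Y) = 2 * card X"
        using card_Un_Int[of X ?Y] finX cardY by simp
      moreover have "card (X \<inter> ?Y) > 0" using meet finX by (simp add: card_gt_0_iff)
      ultimately show ?thesis using half by simp
    qed
    then have "?P (X \<union> ?Y)" using X XV YV by auto
    then have "?d (X \<union> ?Y) \<ge> ?d X0" by (rule X0(2))
    ultimately show False
      using edge_cut_submodular[OF finE, of X ?Y] automorphism_card_edge_cut[OF G \<phi> XV] X(2)
      by simp
  qed
  obtain u where u: "u \<in> X" using X by blast
  have "k \<le> ?d X"
  proof (rule edge_cut_ge_degree_uniform[OF G reg _ XV])
    show "X \<noteq> {}" using X by simp
    show "edge_cut E X \<noteq> {}" using edge_cut_nonempty[OF conn] X by simp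
    fix x assume x: "x \<in> X"
    then obtain \<phi> where \<phi>: "graph_automorphism V E \<phi>" "\<phi> u = x"
      using vt u XV unfolding vertex_transitive_def by blast
    have fix_X: "\<phi> ` X = X"
      using x u \<phi>(2) by (intro stable[OF \<phi>(1)]) blast
    have inj: "inj_on \<phi> V" using \<phi> by (simp add: graph_automorphism_def bij_betw_def)
    show "card {e \<in> E. x \<in> e \<and> \<not> e \<subseteq> X} = card {e \<in> E. u \<in> e \<and> \<not> e \<subseteq> X}"
    proof (rule automorphism_card_edges[OF G \<phi>(1)])
      fix e assume "e \<in> E"
      then have e: "e \<subseteq> V" using G by (simp add: finite_simple_graph_def)
      have "x \<in> \<phi> ` e \<longleftrightarrow> u \<in> e"
        using inj_on_image_mem_iff[OF inj _ e, of u] u XV \<phi>(2) by auto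
      moreover have "\<phi> ` e \<subseteq> X \<longleftrightarrow> e \<subseteq> X"
        using inj_on_image_subset_eq_iff[OF inj e XV] fix_X by simp
      ultimately show "(x \<in> \<phi> ` e \<and> \<not> \<phi> ` e \<subseteq> X) \<longleftrightarrow> (u \<in> e \<and> \<not> e \<subseteq> X)" by simp
    qed
  qed
  also have "\<dots> \<le> ?d Z" using X X0(2)[of Z] Z by simp
  finally show ?thesis .
qed

section \<open>Counting the edges that leave a barrier\<close>

lemma card_disjoint_sets_met_le:
  assumes "pairwise disjnt C" "\<And>X. X \<in> C \<Longrightarrow> X \<inter> A = {}" "finite e"
  shows "card {X \<in> C. e \<inter> X \<noteq> {}} \<le> card (e - A)"
proof -
  have "{X \<in> C. e \<inter> X \<noteq> {}} \<subseteq> (\<lambda>x. THE X. X \<in> C \<and> x \<in> X) ` (e - A)"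
  proof
    fix X assume "X \<in> {X \<in> C. e \<inter> X \<noteq> {}}"
    then obtain x where x: "X \<in> C" "x \<in> e" "x \<in> X" by blast
    then have the: "(THE X. X \<in> C \<and> x \<in> X) = X"
      using assms(1) by (intro the_equality) (auto simp: pairwise_def disjnt_def)
    have mem: "x \<in> e - A" using x assms(2) by blast
    show "X \<in> (\<lambda>x. THE X. X \<in> C \<and> x \<in> X) ` (e - A)"
      by (rule image_eqI[OF _ mem]) (simp only: the)
  qed
  then show ?thesis using assms(3) by (meson finite_Diff surj_card_le)
qed

lemma sum_card_incidences_le:
  assumes "finite C" "finite F" "\<And>e. e \<in> F \<Longrightarrow> card {X \<in> C. e \<inter> X \<noteq> {}} \<le> m"
  shows "(\<Sum>X\<in>C. card {e \<in> F. e \<inter> X \<noteq> {}}) \<le> m * card F"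
proof -
  have "(\<Sum>X\<in>C. card {e \<in> F. e \<inter> X \<noteq> {}}) = (\<Sum>e\<in>F. card {X \<in> C. e \<inter> X \<noteq> {}})"
    using assms(1,2) by (rule sum_multicount_gen) simp
  also have "\<dots> \<le> m * card F"
    using sum_bounded_above[of F _ m] assms(3) by (simp add: mult.commute)
  finally show ?thesis .
qed

text \<open>
  An edge that leaves a member of the barrier ends in \<open>A\<close> unless it belongs to \<open>S\<close>. Edges that
  meet \<open>A\<close> have at most one end outside \<open>A\<close>, so they are counted for at most one member, and there
  are at most \<open>k * card A\<close> of them; edges of \<open>S\<close> are counted for at most two members.
\<close>

lemma preclusion_set_card_ge:
  assumes G: "finite_simple_graph V E" and reg: "regular_graph k V E"
    and even: "even (card V)"
    and cuts: "\<And>X. X \<noteq> {} \<Longrightarrow> X \<subset> V \<Longrightarrow> k \<le> card (edge_cut E X)"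
    and S: "matching_preclusion_set V E S"
  shows "k \<le> card S"
proof -
  have finV: "finite V" using G by (simp add: finite_simple_graph_def)
  have finE: "finite E" using G by (rule finite_simple_graph_finite_edges)
  have SE: "S \<subseteq> E" using S by (simp add: matching_preclusion_set_def)
  then have finS: "finite S" using finE by (rule finite_subset)
  have edge: "card e = 2" "finite e" if "e \<in> E" for e
    using G that finV by (auto simp: finite_simple_graph_def intro: finite_subset)
  have G': "finite_simple_graph V (E - S)" using G by (auto simp: finite_simple_graph_def)
  obtain M where M: "maximum_matching (E - S) M"
    using maximum_matching_exists finE by blast
  then have gM: "graph_matching (E - S) M" by (simp add: maximum_matching_def)
  have "\<not> perfect_matching V (E - S) M"
    using S by (auto simp: matching_preclusion_set_def)
  then have "\<Union>M \<subset> V"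
    using gM G' by (fastforce simp: perfect_matching_def graph_matching_def finite_simple_graph_def)
  then have "2 * card M < card V"
    using card_covered[OF G' gM] finV psubset_card_mono by metis
  \<comment> \<open>Both sides are even, so the difference is at least \<open>2\<close>.\<close>
  then have two: "2 * card M + 2 \<le> card V" using even by presburger
  obtain A C where B: "barrier V (E - S) A C"
    and le: "card V + card A \<le> card C + 2 * card M"
    using tutte_berge_barrier[OF G' M] by blast
  have C: "card A + 2 \<le> card C" using two le by simp
  have AV: "A \<subseteq> V" and disj: "pairwise disjnt C"
    and inC: "\<And>X. X \<in> C \<Longrightarrow> X \<noteq> {} \<and> X \<subseteq> V - A"
    and nbr: "\<And>X e. X \<in> C \<Longrightarrow> e \<in> E - S \<Longrightarrow> e \<inter> X \<noteq> {} \<Longrightarrow> e \<subseteq> X \<union> A"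
    using B unfolding barrier_def by blast+
  have finA: "finite A" using AV finV by (rule finite_subset)
  have finC: "finite C" using C card.infinite by fastforce
  let ?F = "{e \<in> E. e \<inter> A \<noteq> {}}"
  have proper: "X \<subset> V" if X: "X \<in> C" for X
  proof -
    have "\<not> C \<subseteq> {X}" using C card_mono[of "{X}" C] by auto
    then obtain Y where "Y \<in> C" "Y \<noteq> X" by blast
    then show ?thesis
      using disj inC[OF X] inC[of Y] X unfolding pairwise_def disjnt_def by blast
  qed
  have "k * card C = (\<Sum>X\<in>C. k)" by simp
  also have "\<dots> \<le> (\<Sum>X\<in>C. card {e \<in> ?F. e \<inter> X \<noteq> {}} + card {e \<in> S. e \<inter> X \<noteq> {}})"
  proof (rule sum_mono)
    fix X assume X: "X \<in> C"
    have "k \<le> card (edge_cut E X)" using cuts proper inC X by simp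
    also have "\<dots> \<le> card ({e \<in> ?F. e \<inter> X \<noteq> {}} \<union> {e \<in> S. e \<inter> X \<noteq> {}})"
      using nbr[OF X] finE finS by (intro card_mono) (auto simp: edge_cut_def)
    also have "\<dots> \<le> card {e \<in> ?F. e \<inter> X \<noteq> {}} + card {e \<in> S. e \<inter> X \<noteq> {}}"
      by (rule card_Un_le)
    finally show "k \<le> \<dots>" .
  qed
  finally have total: "k * card C \<le>
      (\<Sum>X\<in>C. card {e \<in> ?F. e \<inter> X \<noteq> {}}) + (\<Sum>X\<in>C. card {e \<in> S. e \<inter> X \<noteq> {}})"
    by (simp only: sum.distrib)
  have toA: "(\<Sum>X\<in>C. card {e \<in> ?F. e \<inter> X \<noteq> {}}) \<le> 1 * card ?F"
  proof (rule sum_card_incidences_le[OF finC])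
    fix e assume e: "e \<in> ?F"
    then obtain a where "a \<in> e" "a \<in> A" by blast
    then have "e - A \<subset> e" by blast
    then have "card (e - A) < card e" using edge(2)[of e] e by (simp add: psubset_card_mono)
    moreover have "card {X \<in> C. e \<inter> X \<noteq> {}} \<le> card (e - A)"
      using inC edge(2) e by (intro card_disjoint_sets_met_le[OF disj]) blast+
    ultimately show "card {X \<in> C. e \<inter> X \<noteq> {}} \<le> 1"
      using edge(1)[of e] e by simp
  qed (simp add: finE)
  have inS: "(\<Sum>X\<in>C. card {e \<in> S. e \<inter> X \<noteq> {}}) \<le> 2 * card S"
  proof (rule sum_card_incidences_le[OF finC finS])
    fix e assume "e \<in> S"
    then show "card {X \<in> C. e \<inter> X \<noteq> {}} \<le> 2"
      using card_disjoint_sets_met_le[OF disj, of "{}" e] edge[of e] SE by auto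
  qed
  have "1 * card ?F \<le> card A * k"
  proof -
    have "?F = (\<Union>a\<in>A. {e \<in> E. a \<in> e})" by blast
    then have "card ?F \<le> (\<Sum>a\<in>A. card {e \<in> E. a \<in> e})"
      using card_UN_le[OF finA] by metis
    also have "\<dots> = (\<Sum>a\<in>A. k)"
      using reg AV by (intro sum.cong) (auto simp: regular_graph_def graph_degree_def)
    finally show ?thesis by simp
  qed
  then have "k * card C \<le> card A * k + 2 * card S"
    using total toA inS by linarith
  moreover have "k * (card A + 2) \<le> k * card C" using C by (rule mult_le_mono2)
  ultimately show ?thesis by (simp add: algebra_simps)
qed

section \<open>The matching preclusion number\<close>

lemma edges_at_vertex_preclude:
  assumes "v \<in> V"
  shows "matching_preclusion_set V E {e \<in> E. v \<in> e}"
  using assms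
  by (auto simp: matching_preclusion_set_def perfect_matching_def graph_matching_def)

theorem mainTheorem2:
  fixes V :: "'a set" and E :: "'a set set" and k :: nat
  assumes "k \<ge> 1"
    and "finite_simple_graph V E"
    and "connected_graph V E"
    and "regular_graph k V E"
    and "vertex_transitive V E"
    and "even (card V)"
  shows "matching_preclusion_number V E = k"
  unfolding matching_preclusion_number_def
proof (rule Min_eqI)
  have "{S. matching_preclusion_set V E S} \<subseteq> Pow E"
    by (auto simp: matching_preclusion_set_def)
  then show "finite (card ` {S. matching_preclusion_set V E S})"
    using finite_simple_graph_finite_edges[OF assms(2)] by (simp add: finite_subset)
  show "k \<le> n" if "n \<in> card ` {S. matching_preclusion_set V E S}" for n
    using that preclusion_set_card_ge[OF assms(2,4,6)]
      edge_cut_ge_degree[OF assms(2-5)] by blast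
  obtain v where v: "v \<in> V" using assms(3) by (auto simp: connected_graph_def)
  then have "k = card {e \<in> E. v \<in> e}"
    using assms(4) by (simp add: regular_graph_def graph_degree_def)
  then show "k \<in> card ` {S. matching_preclusion_set V E S}"
    using edges_at_vertex_preclude[OF v] by blast
qed

end
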